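(* Let $n\in\mathbb N$ and let $m_0(\omega)=\sum_{\alpha=0}^{p^n-1}a_\alpha\overline{W_\alpha(\omega)}$ be a Walsh polynomial on $G$. Then the conditions $$m_0(\theta)=1\quad\text{and}\quad\sum_{l=0}^{p-1}|m_0(\omega\oplus\delta_l)|^2\le1\ \text{ for all }\omega\in G$$ hold if and only if the coefficients $a_\alpha$ are given by the discrete Vilenkin-Chrestenson transform $$a_\alpha=p^{-n}\sum_{s=0}^{p^n-1}b_sW_\alpha(A^{-n}h_{[s]}),\qquad 0\le\alpha\le p^n-1,$$ for some complex numbers $b_0,\dots,b_{p^n-1}$ satisfying $$b_0=1,\qquad |b_l|^2+|b_{l+p^{n-1}}|^2+\dots+|b_{l+(p-1)p^{n-1}}|^2\le1,\quad 0\le l\le p^{n-1}-1.$$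
   Context: Fix an integer $p\ge2$. The Vilenkin group $G=G_p$ is the set of sequences $x=(x_j)_{j\in\mathbb Z}$ with $x_j\in\{0,\dots,p-1\}$ and $x_j\neq0$ for at most finitely many negative $j$; the operation $\oplus$ is coordinatewise addition modulo $p$, and $\theta$ is the zero sequence. Put $\lambda(x)=\sum_jx_jp^{-j}$ and $H=\{x\in G:x_j=0\text{ for }j>0\}$; for $\alpha\in\mathbb Z_+=\{0,1,2,\dots\}$, $h_{[\alpha]}$ is the unique element of $H$ with $\lambda(h_{[\alpha]})=\alpha$. $A$ is the automorphism $(Ax)_j=x_{j+1}$. $\chi(x,\omega)=\exp\big(\frac{2\pi i}{p}\sum_{j\in\mathbb Z}x_j\omega_{1-j}\big)$; generalized Walsh functions: $W_\alpha(x)=\chi(x,h_{[\alpha]})$; Walsh polynomials are finite linear combinations of the $W_\alpha$. For $l\in\{0,\dots,p-1\}$, $\delta_l=A^{-1}h_{[l]}$ (coordinate $l$ at index $1$, all other coordinates $0$). *)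

theory Defs
  imports "HOL-Analysis.Analysis" "HOL-Algebra.Group"
begin

definition vilenkin_group :: "nat \<Rightarrow> (int \<Rightarrow> nat) monoid" where
  "vilenkin_group p =
    \<lparr>carrier = {x. (\<forall>j. x j \<in> {0..<p}) \<and> finite {j. j < 0 \<and> x j \<noteq> 0}},
     mult = (\<lambda>x y j. (x j + y j) mod p),
     one = (\<lambda>j. 0)\<rparr>"

definition vilenkin_lambda :: "nat \<Rightarrow> (int \<Rightarrow> nat) \<Rightarrow> real" where
  "vilenkin_lambda p x = (\<Sum>\<^sub>\<infinity>j. real (x j) * real p powi (- j))"

definition vilenkin_H :: "nat \<Rightarrow> (int \<Rightarrow> nat) set" where
  "vilenkin_H p = {x \<in> carrier (vilenkin_group p). \<forall>j>0. x j = 0}"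

definition vilenkin_h :: "nat \<Rightarrow> nat \<Rightarrow> int \<Rightarrow> nat" where
  "vilenkin_h p \<alpha> = (THE h. h \<in> vilenkin_H p \<and> vilenkin_lambda p h = real \<alpha>)"

definition vilenkin_A :: "(int \<Rightarrow> nat) \<Rightarrow> int \<Rightarrow> nat" where
  "vilenkin_A x = (\<lambda>j. x (j + 1))"

text \<open>For \<open>x\<close> and \<open>\<omega>\<close> in the Vilenkin group only finitely many summands are nonzero.\<close>

definition vilenkin_chi :: "nat \<Rightarrow> (int \<Rightarrow> nat) \<Rightarrow> (int \<Rightarrow> nat) \<Rightarrow> complex" where
  "vilenkin_chi p x \<omega> =
    exp (2 * complex_of_real pi * \<i> / of_nat p * (\<Sum>\<^sub>\<infinity>j. of_nat (x j) * of_nat (\<omega> (1 - j))))"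

definition walsh :: "nat \<Rightarrow> nat \<Rightarrow> (int \<Rightarrow> nat) \<Rightarrow> complex" where
  "walsh p \<alpha> x = vilenkin_chi p x (vilenkin_h p \<alpha>)"

text \<open>Since \<open>vilenkin_A\<close> is a bijection of the whole type \<open>int \<Rightarrow> nat\<close> (\<open>bij_vilenkin_A\<close>
  below), \<open>inv_into UNIV\<close> gives its genuine inverse.\<close>

definition vilenkin_delta :: "nat \<Rightarrow> nat \<Rightarrow> int \<Rightarrow> nat" where
  "vilenkin_delta p l = inv_into UNIV vilenkin_A (vilenkin_h p l)"

lemma inv_vilenkin_A: "inv_into UNIV vilenkin_A x = (\<lambda>j. x (j - 1))"
  by (rule inv_f_eq) (auto simp: vilenkin_A_def inj_def fun_eq_iff, metis diff_add_cancel)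

lemma bij_vilenkin_A: "bij vilenkin_A"
  by (rule bij_betw_byWitness[where f' = "\<lambda>x j. x (j - 1)"]) (auto simp: vilenkin_A_def)

lemma comm_group_vilenkin_group:
  assumes "p > 0"
  shows "comm_group (vilenkin_group p)"
proof (rule comm_groupI)
  fix x y assume *: "x \<in> carrier (vilenkin_group p)" "y \<in> carrier (vilenkin_group p)"
  have "{j. j < 0 \<and> (x j + y j) mod p \<noteq> 0} \<subseteq> {j. j < 0 \<and> x j \<noteq> 0} \<union> {j. j < 0 \<and> y j \<noteq> 0}"
    by (auto intro!: gr0I)
  then have "finite {j. j < 0 \<and> (x j + y j) mod p \<noteq> 0}"
    by (rule finite_subset) (use * in \<open>simp add: vilenkin_group_def\<close>)
  then show "x \<otimes>\<^bsub>vilenkin_group p\<^esub> y \<in> carrier (vilenkin_group p)"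
    using assms by (simp add: vilenkin_group_def)
next
  fix x assume *: "x \<in> carrier (vilenkin_group p)"
  let ?y = "\<lambda>j. (p - x j) mod p"
  have "{j. j < 0 \<and> ?y j \<noteq> 0} \<subseteq> {j. j < 0 \<and> x j \<noteq> 0}"
    by (auto intro!: gr0I)
  then have "finite {j. j < 0 \<and> ?y j \<noteq> 0}"
    by (rule finite_subset) (use * in \<open>simp add: vilenkin_group_def\<close>)
  then have "?y \<in> carrier (vilenkin_group p)"
    using assms by (simp add: vilenkin_group_def)
  moreover have "?y \<otimes>\<^bsub>vilenkin_group p\<^esub> x = \<one>\<^bsub>vilenkin_group p\<^esub>"
    using * by (simp add: vilenkin_group_def fun_eq_iff mod_add_left_eq less_imp_le)
  ultimately show "\<exists>y\<in>carrier (vilenkin_group p). y \<otimes>\<^bsub>vilenkin_group p\<^esub> x = \<one>\<^bsub>vilenkin_group p\<^esub>"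
    by blast
qed (use assms in \<open>simp_all add: vilenkin_group_def mod_add_left_eq mod_add_right_eq ac_simps\<close>)

lemma vilenkin_H_lambda:
  assumes h: "h \<in> vilenkin_H p"
  shows "\<exists>N. (\<forall>i\<ge>N. h (- int i) = 0) \<and>
    vilenkin_lambda p h = real (\<Sum>i<N. h (- int i) * p ^ i)"
proof -
  have "finite {j. j < 0 \<and> h j \<noteq> 0}"
    using h by (auto simp: vilenkin_H_def vilenkin_group_def)
  then obtain m where m: "\<And>j. j < 0 \<Longrightarrow> h j \<noteq> 0 \<Longrightarrow> m < j"
    by (metis (mono_tags, lifting) bdd_below.E bdd_below_finite lt_ex mem_Collect_eq order_less_le_trans)
  define N where "N = nat (- m) + 1"
  have N: "h (- int i) = 0" if "i \<ge> N" for i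
    using m[of "- int i"] that by (force simp: N_def)
  have "vilenkin_lambda p h = (\<Sum>\<^sub>\<infinity>j\<in>(\<lambda>i. - int i) ` {..<N}. real (h j) * real p powi (- j))"
    unfolding vilenkin_lambda_def
  proof (rule infsum_cong_neutral)
    fix j :: int assume "j \<in> UNIV - (\<lambda>i. - int i) ` {..<N}"
    then have j: "j \<noteq> - int i" if "i < N" for i using that by auto
    have "h j = 0"
    proof (cases "j > 0")
      case True
      then show ?thesis using h by (simp add: vilenkin_H_def)
    next
      case False
      then have "j = - int (nat (- j))" by simp
      then show ?thesis using N j by (metis linorder_not_less)
    qed
    then show "real (h j) * real p powi (- j) = 0" by simp
  qed auto
  also have "\<dots> = (\<Sum>i<N. real (h (- int i)) * real p ^ i)"
    by (subst infsum_finite) (auto simp: sum.reindex inj_on_def)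
  finally show ?thesis using N by auto
qed

lemma digit_sum:
  fixes d :: "nat \<Rightarrow> nat"
  assumes "\<And>i. d i < p"
  shows "k < N \<Longrightarrow> (\<Sum>i<N. d i * p ^ i) div p ^ k mod p = d k"
  using assms
proof (induction k arbitrary: d N)
  case (0 d N)
  then obtain M where N: "N = Suc M" by (cases N) auto
  have "(\<Sum>i<N. d i * p ^ i) = d 0 + p * (\<Sum>i<M. d (Suc i) * p ^ i)"
    unfolding N by (subst sum.lessThan_Suc_shift) (simp add: sum_distrib_left ac_simps)
  then show ?case using 0 by simp
next
  case (Suc k d N)
  then obtain M where N: "N = Suc M" by (cases N) auto
  have "(\<Sum>i<N. d i * p ^ i) = d 0 + p * (\<Sum>i<M. d (Suc i) * p ^ i)"
    unfolding N by (subst sum.lessThan_Suc_shift) (simp add: sum_distrib_left ac_simps)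
  moreover have "0 < p" "d 0 < p" using Suc.prems(2) by (auto intro: le_less_trans)
  ultimately have "(\<Sum>i<N. d i * p ^ i) div p ^ Suc k = (\<Sum>i<M. d (Suc i) * p ^ i) div p ^ k"
    by (simp add: div_mult2_eq)
  then show ?case using Suc.IH[of M "\<lambda>i. d (Suc i)"] Suc.prems N by simp
qed

lemma sum_digits:
  fixes \<alpha> p :: nat
  shows "(\<Sum>i<N. (\<alpha> div p ^ i mod p) * p ^ i) = \<alpha> mod p ^ N"
  by (induction N) (simp_all add: mod_mult2_eq mult.commute[of p])

lemma vilenkin_h_ex1:
  assumes "p \<ge> 2"
  shows "\<exists>!h. h \<in> vilenkin_H p \<and> vilenkin_lambda p h = real \<alpha>"
proof (rule ex_ex1I)
  let ?h = "\<lambda>j::int. if j > 0 then 0 else \<alpha> div p ^ nat (- j) mod p"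
  have small: "\<alpha> < p ^ i" if "\<alpha> \<le> i" for i
    using that assms by (meson less_exp order_le_less_trans order_less_le_trans power_mono zero_le)
  have "{j. j < 0 \<and> ?h j \<noteq> 0} \<subseteq> {- int \<alpha>..0}"
  proof
    fix j assume j: "j \<in> {j. j < 0 \<and> ?h j \<noteq> 0}"
    then have "\<not> \<alpha> < p ^ nat (- j)" by auto
    then have "\<not> \<alpha> \<le> nat (- j)" using small by blast
    with j show "j \<in> {- int \<alpha>..0}" by auto
  qed
  then have "finite {j. j < 0 \<and> ?h j \<noteq> 0}"
    by (rule finite_subset) simp
  then have H: "?h \<in> vilenkin_H p"
    using assms by (simp add: vilenkin_H_def vilenkin_group_def)
  obtain N where N: "\<forall>i\<ge>N. ?h (- int i) = 0"
    "vilenkin_lambda p ?h = real (\<Sum>i<N. ?h (- int i) * p ^ i)"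
    using vilenkin_H_lambda[OF H] by blast
  have "(\<Sum>i<N. ?h (- int i) * p ^ i) = (\<Sum>i<max N \<alpha>. ?h (- int i) * p ^ i)"
    by (rule sum.mono_neutral_left) (use N(1) in auto)
  also have "\<dots> = \<alpha> mod p ^ max N \<alpha>"
    by (simp add: sum_digits)
  also have "\<dots> = \<alpha>" using small[of "max N \<alpha>"] by simp
  finally show "\<exists>h. h \<in> vilenkin_H p \<and> vilenkin_lambda p h = real \<alpha>"
    using H N(2) by (intro exI[of _ ?h]) simp
next
  fix g h
  assume g: "g \<in> vilenkin_H p \<and> vilenkin_lambda p g = real \<alpha>"
    and h: "h \<in> vilenkin_H p \<and> vilenkin_lambda p h = real \<alpha>"
  have digits: "f (- int k) = \<alpha> div p ^ k mod p"
    if f: "f \<in> vilenkin_H p" "vilenkin_lambda p f = real \<alpha>" for f k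
  proof -
    obtain N where N: "\<forall>i\<ge>N. f (- int i) = 0"
      "real \<alpha> = real (\<Sum>i<N. f (- int i) * p ^ i)"
      using vilenkin_H_lambda[OF f(1)] f(2) by metis
    have "\<alpha> = (\<Sum>i<N. f (- int i) * p ^ i)" using N(2) by linarith
    also have "\<dots> = (\<Sum>i<max N (Suc k). f (- int i) * p ^ i)"
      by (rule sum.mono_neutral_left) (use N(1) in auto)
    finally show ?thesis
      using digit_sum[of "\<lambda>i. f (- int i)" p k "max N (Suc k)"] f(1)
      by (auto simp: vilenkin_H_def vilenkin_group_def)
  qed
  show "g = h"
  proof
    fix j :: int
    show "g j = h j"
    proof (cases "j > 0")
      case True
      then show ?thesis using g h by (auto simp: vilenkin_H_def)
    next
      case False
      then have "j = - int (nat (- j))" by simp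
      then show ?thesis using digits g h by metis
    qed
  qed
qed

lemma vilenkin_delta_eq:
  assumes "p \<ge> 2" "l < p"
  shows "vilenkin_delta p l = (\<lambda>j. if j = 1 then l else 0)"
proof -
  let ?h = "\<lambda>j::int. if j = 0 then l else 0"
  have H: "?h \<in> vilenkin_H p"
    using assms by (simp add: vilenkin_H_def vilenkin_group_def)
  have "vilenkin_lambda p ?h = (\<Sum>\<^sub>\<infinity>j\<in>{0}. real (?h j) * real p powi (- j))"
    unfolding vilenkin_lambda_def by (rule infsum_cong_neutral) auto
  then have "vilenkin_lambda p ?h = real l" by simp
  then have "vilenkin_h p l = ?h"
    unfolding vilenkin_h_def using the1_equality[OF vilenkin_h_ex1[OF assms(1)]] H by blast
  then show ?thesis by (auto simp: vilenkin_delta_def inv_vilenkin_A)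
qed

end

theory Submission
  imports Defs
begin

text \<open>
  For \<open>\<alpha> < p ^ n\<close> the value \<open>W\<^sub>\<alpha>(\<omega>)\<close> depends only on the coordinates \<open>\<omega>\<^sub>1, \<dots>, \<omega>\<^sub>n\<close>,
  that is, on the number \<open>s = \<omega>\<^sub>1 p\<^bsup>n-1\<^esup> + \<dots> + \<omega>\<^sub>n\<close>, and \<open>s\<close> is also the number belonging to
  \<open>A\<^bsup>-n\<^esup> h\<^sub>s\<close>. Hence \<open>m\<^sub>0\<close> takes only the values \<open>b\<^sub>s = m\<^sub>0(A\<^bsup>-n\<^esup> h\<^sub>s)\<close>, and the
  coefficients are recovered from them by orthogonality of the characters of the finite group
  of digit strings. Adding \<open>\<delta>\<^sub>l\<close> rotates the leading digit of \<open>s\<close>, so the sum over \<open>l\<close> runs over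
  a coset of the multiples of \<open>p\<^bsup>n-1\<^esup>\<close>.
\<close>

section \<open>Digits of \<open>h\<close> and Walsh functions as finite products\<close>

text \<open>Replaces the definite description of \<open>h\<close> by base-\<open>p\<close> digits:
  uniqueness of digits lets them be read off from \<open>vilenkin_lambda\<close>.\<close>

lemma vilenkin_h_digit:
  assumes "p \<ge> 2"
  shows "vilenkin_h p \<alpha> (- int k) = \<alpha> div p ^ k mod p"
    and "j > 0 \<Longrightarrow> vilenkin_h p \<alpha> j = 0"
    and "vilenkin_h p \<alpha> \<in> carrier (vilenkin_group p)"
proof -
  define h where "h = vilenkin_h p \<alpha>"
  have h: "h \<in> vilenkin_H p" "vilenkin_lambda p h = real \<alpha>"
    unfolding h_def vilenkin_h_def using theI'[OF vilenkin_h_ex1[OF assms, of \<alpha>]] by auto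
  obtain N where N: "\<forall>i\<ge>N. h (- int i) = 0"
    "real \<alpha> = real (\<Sum>i<N. h (- int i) * p ^ i)"
    using vilenkin_H_lambda[OF h(1)] h(2) by metis
  have "\<alpha> = (\<Sum>i<N. h (- int i) * p ^ i)" using N(2) by linarith
  \<comment> \<open>Padding with zero digits puts position \<open>k\<close> inside the range, as
    \<open>digit_sum\<close> demands.\<close>
  also have "\<dots> = (\<Sum>i<max N (Suc k). h (- int i) * p ^ i)"
    by (rule sum.mono_neutral_left) (use N(1) in auto)
  finally show "vilenkin_h p \<alpha> (- int k) = \<alpha> div p ^ k mod p"
    using digit_sum[of "\<lambda>i. h (- int i)" p k "max N (Suc k)"] h(1)
    by (auto simp: vilenkin_H_def vilenkin_group_def h_def)
  show "j > 0 \<Longrightarrow> vilenkin_h p \<alpha> j = 0" "vilenkin_h p \<alpha> \<in> carrier (vilenkin_group p)"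
    using h(1) by (auto simp: h_def vilenkin_H_def)
qed

lemma inv_vilenkin_A_funpow:
  "(inv_into UNIV vilenkin_A ^^ n) x = (\<lambda>j. x (j - int n))"
  by (induction n) (simp_all add: inv_vilenkin_A algebra_simps)

lemma inv_vilenkin_A_funpow_carrier:
  assumes "x \<in> carrier (vilenkin_group p)"
  shows "(inv_into UNIV vilenkin_A ^^ n) x \<in> carrier (vilenkin_group p)"
proof -
  have "{j. j < 0 \<and> x (j - int n) \<noteq> 0} \<subseteq> (\<lambda>j. j + int n) ` {j. j < 0 \<and> x j \<noteq> 0}"
    by (auto intro: image_eqI[where x = "_ - int n"])
  then have "finite {j. j < 0 \<and> x (j - int n) \<noteq> 0}"
    by (rule finite_subset) (use assms in \<open>simp add: vilenkin_group_def\<close>)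
  then show ?thesis
    using assms by (simp add: inv_vilenkin_A_funpow vilenkin_group_def)
qed

text \<open>Digit \<open>i\<close> of \<alpha> sits at index \<open>- i\<close>, which
  \<open>1 - j\<close> hits exactly for \<open>j = i + 1\<close>. Digits from position
  \<open>n\<close> on vanish because \<alpha> is below \<open>p ^ n\<close>, so \<open>n\<close>
  terms of the exponent survive.\<close>

lemma walsh_eq_prod:
  assumes p: "p \<ge> 2" and \<alpha>: "\<alpha> < p ^ n"
  shows "walsh p \<alpha> x =
    (\<Prod>i<n. cis (2 * pi / real p) ^ (x (int i + 1) * (\<alpha> div p ^ i mod p)))"
proof -
  let ?g = "\<lambda>j. of_nat (x j) * of_nat (vilenkin_h p \<alpha> (1 - j)) :: complex"
  have "(\<Sum>\<^sub>\<infinity>j. ?g j) = (\<Sum>\<^sub>\<infinity>j\<in>(\<lambda>i. int i + 1) ` {..<n}. ?g j)"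
  proof (rule infsum_cong_neutral)
    fix j :: int assume "j \<in> UNIV - (\<lambda>i. int i + 1) ` {..<n}"
    then have j: "j \<noteq> int i + 1" if "i < n" for i using that by auto
    have "vilenkin_h p \<alpha> (1 - j) = 0"
    proof (cases "j \<ge> 1")
      case True
      then obtain i where i: "j = int i + 1"
        by (metis add.commute zle_iff_zadd)
      then have "p ^ n \<le> p ^ i"
        using j[of i] p by (intro power_increasing) (cases "i < n", auto)
      then have "\<alpha> div p ^ i = 0" using \<alpha> by simp
      then show ?thesis
        using i vilenkin_h_digit(1)[OF p, of \<alpha> i] by simp
    qed (simp add: vilenkin_h_digit(2)[OF p])
    then show "?g j = 0" by simp
  qed auto
  also have "\<dots> = (\<Sum>i<n. of_nat (x (int i + 1) * (\<alpha> div p ^ i mod p)))"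
    by (subst infsum_finite) (auto simp: sum.reindex inj_on_def vilenkin_h_digit(1)[OF p])
  finally have sum: "(\<Sum>\<^sub>\<infinity>j. ?g j) = (\<Sum>i<n. of_nat (x (int i + 1) * (\<alpha> div p ^ i mod p)))" .
  have "walsh p \<alpha> x =
      exp (\<Sum>i<n. of_nat (x (int i + 1) * (\<alpha> div p ^ i mod p)) * (\<i> * of_real (2 * pi / real p)))"
    unfolding walsh_def vilenkin_chi_def sum
    by (simp add: sum_distrib_right sum_distrib_left mult_ac)
  also have "\<dots> = (\<Prod>i<n. cis (2 * pi / real p) ^ (x (int i + 1) * (\<alpha> div p ^ i mod p)))"
    by (simp only: exp_sum finite_lessThan exp_of_nat_mult cis_conv_exp)
  finally show ?thesis .
qed

section \<open>The finite transform and its inversion\<close>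

text \<open>For \<alpha> and \<open>s\<close> below \<open>p ^ n\<close> this is the Walsh function
  at the point of index \<open>s\<close>. The digits of \<open>s\<close> are reversed since
  coordinate \<open>i + 1\<close> of that point is digit \<open>n - 1 - i\<close> of
  \<open>s\<close>.\<close>

definition vc_kernel :: "nat \<Rightarrow> nat \<Rightarrow> nat \<Rightarrow> nat \<Rightarrow> complex" where
  "vc_kernel p n \<alpha> s =
    (\<Prod>i<n. cis (2 * pi / real p) ^ ((s div p ^ (n - 1 - i) mod p) * (\<alpha> div p ^ i mod p)))"

text \<open>The reversal of the product index exchanges the two digit strings.\<close>

lemma vc_kernel_commute: "vc_kernel p n \<alpha> s = vc_kernel p n s \<alpha>"
  unfolding vc_kernel_def
  by (subst prod.nat_diff_reindex[symmetric], rule prod.cong) (auto simp: mult.commute)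

text \<open>The numbers below \<open>p ^ n\<close> are all digit strings of length \<open>n\<close>,
  so the sum factors digit by digit. The induction splits off the leading digit.\<close>

lemma sum_prod_digits:
  fixes c :: "nat \<Rightarrow> complex"
  assumes "p > 0"
  shows "(\<Sum>\<alpha>=0..<p ^ n. \<Prod>i<n. c i ^ (\<alpha> div p ^ i mod p)) = (\<Prod>i<n. \<Sum>d=0..<p. c i ^ d)"
proof (induction n)
  case (Suc n)
  let ?f = "\<lambda>\<alpha>. \<Prod>i<n. c i ^ (\<alpha> div p ^ i mod p)"
  have low: "?f (r + p ^ n * d) = ?f r" for r d
  proof (rule prod.cong)
    fix i assume "i \<in> {..<n}"
    then obtain k where "n = Suc (i + k)"
      using less_imp_Suc_add by auto
    \<comment> \<open>After division by \<open>p ^ i\<close> the added term is still a multiple of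
      \<open>p\<close>, so digit \<open>i\<close> is unchanged.\<close>
    then have e: "r + p ^ n * d = r + p ^ i * (p * (p ^ k * d))"
      by (simp add: power_add)
    have "(r + p ^ n * d) div p ^ i = r div p ^ i + p * (p ^ k * d)"
      using assms unfolding e using div_mult_self2[of "p ^ i" r "p * (p ^ k * d)"] by simp
    then show "c i ^ ((r + p ^ n * d) div p ^ i mod p) = c i ^ (r div p ^ i mod p)"
      by simp
  qed simp
  have "(\<Sum>\<alpha>=0..<p ^ Suc n. \<Prod>i<Suc n. c i ^ (\<alpha> div p ^ i mod p)) =
      (\<Sum>(r, d)\<in>{0..<p ^ n} \<times> {0..<p}. ?f r * c n ^ d)"
  proof (rule sum.reindex_bij_witness[where
        i = "\<lambda>(r, d). r + p ^ n * d" and j = "\<lambda>\<alpha>. (\<alpha> mod p ^ n, \<alpha> div p ^ n)"])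
    fix \<alpha> assume "\<alpha> \<in> {0..<p ^ Suc n}"
    then have d: "\<alpha> div p ^ n < p"
      using assms by (simp add: less_mult_imp_div_less)
    then show "(\<alpha> mod p ^ n, \<alpha> div p ^ n) \<in> {0..<p ^ n} \<times> {0..<p}"
      using assms by simp
    show "(case (\<alpha> mod p ^ n, \<alpha> div p ^ n) of (r, d) \<Rightarrow> ?f r * c n ^ d) =
        (\<Prod>i<Suc n. c i ^ (\<alpha> div p ^ i mod p))"
      using d low[of "\<alpha> mod p ^ n" "\<alpha> div p ^ n"] by simp
  next
    fix rd assume "rd \<in> {0..<p ^ n} \<times> {0..<p}"
    then obtain r d where rd: "rd = (r, d)" "r < p ^ n" "d < p" by auto
    have "r + p ^ n * d < p ^ n * Suc d" using rd by simp
    also have "\<dots> \<le> p ^ n * p" using rd by (intro mult_left_mono) auto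
    finally show "(case rd of (r, d) \<Rightarrow> r + p ^ n * d) \<in> {0..<p ^ Suc n}"
      using rd by (simp add: mult.commute)
    show "((case rd of (r, d) \<Rightarrow> r + p ^ n * d) mod p ^ n,
        (case rd of (r, d) \<Rightarrow> r + p ^ n * d) div p ^ n) = rd"
      using rd by simp
  qed simp
  also have "\<dots> = (\<Sum>r=0..<p ^ n. ?f r) * (\<Sum>d=0..<p. c n ^ d)"
    by (simp add: sum_product sum.cartesian_product)
  finally show ?case using Suc by simp
qed simp

text \<open>Conjugation inverts on the unit circle, and the \<open>p\<close>-th roots of unity with
  exponents below \<open>p\<close> are distinct.\<close>

lemma cis_power_eq_1_iff:
  assumes "u < p" "v < p"
  shows "cis (2 * pi / real p) ^ u * cnj (cis (2 * pi / real p) ^ v) = 1 \<longleftrightarrow> u = v"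
proof -
  have inj: "inj_on (\<lambda>k. cis (2 * pi * real k / real p)) {..<p}"
    using assms Complex.bij_betw_roots_unity[of p] by (auto simp: bij_betw_def)
  have pow: "cis (2 * pi / real p) ^ u = cis (2 * pi * real u / real p)" for u
    by (simp add: Complex.DeMoivre mult_ac)
  have "cis (2 * pi / real p) ^ u * cnj (cis (2 * pi / real p) ^ v) = 1 \<longleftrightarrow>
      cis (2 * pi / real p) ^ u = cis (2 * pi / real p) ^ v"
    unfolding pow by (simp add: cis_cnj cis_inverse[symmetric] field_simps del: cis_inverse)
  also have "\<dots> \<longleftrightarrow> u = v"
    unfolding pow using inj_on_eq_iff[OF inj, of u v] assms by simp
  finally show ?thesis .
qed

text \<open>Orthogonality for a single digit: a geometric sum over a \<open>p\<close>-th root of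
  unity, which vanishes unless the root is 1.\<close>

lemma sum_powers_cis:
  assumes "u < p" "v < p"
  shows "(\<Sum>d=0..<p. (cis (2 * pi / real p) ^ u * cnj (cis (2 * pi / real p) ^ v)) ^ d) =
    (if u = v then of_nat p else 0)"
proof (cases "u = v")
  case True
  then show ?thesis using cis_power_eq_1_iff[OF assms] by simp
next
  case False
  define z where "z = cis (2 * pi / real p) ^ u * cnj (cis (2 * pi / real p) ^ v)"
  have "cis (2 * pi / real p) ^ p = 1"
    using assms by (simp add: Complex.DeMoivre)
  then have "z ^ p = 1"
    unfolding z_def power_mult_distrib complex_cnj_power[symmetric] power_mult[symmetric]
    by (simp only: mult.commute[of _ p] power_mult complex_cnj_power) simp
  moreover have "z \<noteq> 1" using False cis_power_eq_1_iff[OF assms] by (simp add: z_def)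
  ultimately show ?thesis
    using False unfolding z_def[symmetric] by (simp add: atLeast0LessThan sum_gp_strict)
qed

lemma digits_eq_imp_eq:
  fixes s t p :: nat
  assumes "s < p ^ n" "t < p ^ n" "\<And>i. i < n \<Longrightarrow> s div p ^ i mod p = t div p ^ i mod p"
  shows "s = t"
proof -
  have "s mod p ^ n = t mod p ^ n"
    unfolding sum_digits[symmetric] using assms(3) by (intro sum.cong) auto
  then show ?thesis using assms by simp
qed

text \<open>The sum factors into single-digit sums, each \<open>p\<close> or 0; one differing digit
  makes the product vanish.\<close>

lemma vc_kernel_orthogonal:
  assumes p: "p > 0" and s: "s < p ^ n" and t: "t < p ^ n"
  shows "(\<Sum>\<alpha>=0..<p ^ n. vc_kernel p n \<alpha> s * cnj (vc_kernel p n \<alpha> t)) =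
    (if s = t then of_nat (p ^ n) else 0)"
proof -
  let ?z = "cis (2 * pi / real p)"
  define u where "u = (\<lambda>s i. s div p ^ (n - 1 - i) mod p)"
  have "(\<Sum>\<alpha>=0..<p ^ n. vc_kernel p n \<alpha> s * cnj (vc_kernel p n \<alpha> t)) =
      (\<Sum>\<alpha>=0..<p ^ n. \<Prod>i<n. (?z ^ u s i * cnj (?z ^ u t i)) ^ (\<alpha> div p ^ i mod p))"
    unfolding vc_kernel_def u_def
    by (simp only: cnj_prod prod.distrib[symmetric] power_mult power_mult_distrib complex_cnj_power)
  also have "\<dots> = (\<Prod>i<n. if u s i = u t i then of_nat p else 0)"
    unfolding sum_prod_digits[OF p]
    by (intro prod.cong refl sum_powers_cis) (simp_all add: u_def p)
  also have "\<dots> = (if s = t then of_nat (p ^ n) else 0)"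
  proof (cases "s = t")
    case False
    then obtain i where i: "i < n" "s div p ^ i mod p \<noteq> t div p ^ i mod p"
      using digits_eq_imp_eq[OF s t] by blast
    \<comment> \<open>Digit \<open>i\<close> enters through factor \<open>n - 1 - i\<close>, because
      \<open>u\<close> reads digits from the top.\<close>
    then have "n - 1 - i < n" "u s (n - 1 - i) \<noteq> u t (n - 1 - i)"
      by (auto simp: u_def)
    with False show ?thesis by (auto intro!: prod_zero)
  qed simp
  finally show ?thesis .
qed

text \<open>Recovers values from coefficients: after swapping the sums, orthogonality leaves only
  the term \<open>s = t\<close>.\<close>

lemma vc_transform_inverse:
  assumes p: "p > 0" and t: "t < p ^ n"
  shows "(\<Sum>\<alpha>=0..<p ^ n. (1 / of_nat (p ^ n) * (\<Sum>s=0..<p ^ n. b s * vc_kernel p n \<alpha> s)) *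
    cnj (vc_kernel p n \<alpha> t)) = b t"
proof -
  have "(\<Sum>\<alpha>=0..<p ^ n. (1 / of_nat (p ^ n) * (\<Sum>s=0..<p ^ n. b s * vc_kernel p n \<alpha> s)) *
      cnj (vc_kernel p n \<alpha> t)) =
    (\<Sum>\<alpha>=0..<p ^ n. \<Sum>s=0..<p ^ n.
      b s / of_nat (p ^ n) * (vc_kernel p n \<alpha> s * cnj (vc_kernel p n \<alpha> t)))"
    by (simp add: sum_distrib_left sum_distrib_right mult_ac)
  also have "\<dots> = (\<Sum>s=0..<p ^ n. b s / of_nat (p ^ n) *
      (\<Sum>\<alpha>=0..<p ^ n. vc_kernel p n \<alpha> s * cnj (vc_kernel p n \<alpha> t)))"
    by (subst sum.swap) (simp only: sum_distrib_left)
  also have "\<dots> = (\<Sum>s=0..<p ^ n. if s = t then b s else 0)"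
    using p t by (intro sum.cong) (auto simp: vc_kernel_orthogonal)
  also have "\<dots> = b t" using t by simp
  finally show ?thesis .
qed

text \<open>The opposite composition follows by conjugating the previous inversion and using the
  symmetry of the kernel.\<close>

lemma vc_transform_inverse':
  assumes p: "p > 0" and \<beta>: "\<beta> < p ^ n"
  shows "1 / of_nat (p ^ n) *
    (\<Sum>s=0..<p ^ n. (\<Sum>\<alpha>=0..<p ^ n. a \<alpha> * cnj (vc_kernel p n \<alpha> s)) * vc_kernel p n \<beta> s) = a \<beta>"
proof -
  have "a \<beta> = cnj (\<Sum>s=0..<p ^ n. (1 / of_nat (p ^ n) *
      (\<Sum>\<alpha>=0..<p ^ n. cnj (a \<alpha>) * vc_kernel p n s \<alpha>)) * cnj (vc_kernel p n s \<beta>))"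
    using vc_transform_inverse[OF assms, of "\<lambda>\<alpha>. cnj (a \<alpha>)"] by simp
  also have "\<dots> = 1 / of_nat (p ^ n) *
      (\<Sum>s=0..<p ^ n. (\<Sum>\<alpha>=0..<p ^ n. a \<alpha> * cnj (vc_kernel p n s \<alpha>)) * vc_kernel p n s \<beta>)"
    by (simp add: sum_distrib_left mult_ac)
  finally show ?thesis by (simp only: vc_kernel_commute[of p n])
qed

section \<open>Group elements as numbers, and translation by \<open>vilenkin_delta\<close>\<close>

text \<open>This is \<open>p ^ n\<close> times the contribution of coordinates 1 to \<open>n\<close>
  to \<open>vilenkin_lambda\<close>; coordinate 1 is the leading digit.\<close>

definition vilenkin_index :: "nat \<Rightarrow> nat \<Rightarrow> (int \<Rightarrow> nat) \<Rightarrow> nat" where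
  "vilenkin_index p n \<omega> = (\<Sum>i<n. \<omega> (int n - int i) * p ^ i)"

lemma digit_sum_less:
  fixes d :: "nat \<Rightarrow> nat"
  assumes "\<And>i. i < n \<Longrightarrow> d i < p"
  shows "(\<Sum>i<n. d i * p ^ i) < p ^ n"
  using assms
proof (induction n)
  case (Suc n)
  have "(\<Sum>i<Suc n. d i * p ^ i) < Suc (d n) * p ^ n" using Suc by simp
  also have "\<dots> \<le> p * p ^ n" using Suc.prems[of n] by (intro mult_right_mono) auto
  finally show ?case by simp
qed simp

text \<open>Shows that every number below \<open>p ^ n\<close> occurs as an index.\<close>

lemma vilenkin_index_inv_A_h:
  assumes "p \<ge> 2" "s < p ^ n"
  shows "vilenkin_index p n ((inv_into UNIV vilenkin_A ^^ n) (vilenkin_h p s)) = s"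
  using assms sum_digits[of s p n]
  by (simp add: vilenkin_index_def inv_vilenkin_A_funpow vilenkin_h_digit(1))

lemma walsh_eq_vc_kernel:
  assumes "p \<ge> 2" "\<alpha> < p ^ n" "\<omega> \<in> carrier (vilenkin_group p)"
  shows "walsh p \<alpha> \<omega> = vc_kernel p n \<alpha> (vilenkin_index p n \<omega>)"
  unfolding walsh_eq_prod[OF assms(1,2)] vc_kernel_def
proof (rule prod.cong)
  fix i assume i: "i \<in> {..<n}"
  then have "vilenkin_index p n \<omega> div p ^ (n - 1 - i) mod p = \<omega> (int n - int (n - 1 - i))"
    unfolding vilenkin_index_def using assms(3)
    by (intro digit_sum) (auto simp: vilenkin_group_def)
  also have "\<dots> = \<omega> (int i + 1)" using i by (simp add: of_nat_diff algebra_simps)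
  finally show "cis (2 * pi / real p) ^ (\<omega> (int i + 1) * (\<alpha> div p ^ i mod p)) =
    cis (2 * pi / real p) ^ ((vilenkin_index p n \<omega> div p ^ (n - 1 - i) mod p) * (\<alpha> div p ^ i mod p))"
    by simp
qed simp

text \<open>The translation changes only coordinate 1, the digit of weight \<open>p ^ m\<close>, and
  group addition has no carries.\<close>

lemma vilenkin_index_mult_delta:
  assumes p: "p \<ge> 2" and l: "l < p" and \<omega>: "\<omega> \<in> carrier (vilenkin_group p)"
  shows "vilenkin_index p (Suc m) (\<omega> \<otimes>\<^bsub>vilenkin_group p\<^esub> vilenkin_delta p l) =
    vilenkin_index p (Suc m) \<omega> mod p ^ m + ((\<omega> 1 + l) mod p) * p ^ m"
proof -
  define r where "r = (\<Sum>i<m. \<omega> (int (Suc m) - int i) * p ^ i)"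
  have w: "\<omega> j < p" for j using \<omega> by (simp add: vilenkin_group_def)
  have "r < p ^ m" unfolding r_def by (rule digit_sum_less) (rule w)
  moreover have "vilenkin_index p (Suc m) \<omega> = r + \<omega> 1 * p ^ m"
    by (simp add: vilenkin_index_def r_def)
  moreover have "vilenkin_index p (Suc m) (\<omega> \<otimes>\<^bsub>vilenkin_group p\<^esub> vilenkin_delta p l) =
      r + ((\<omega> 1 + l) mod p) * p ^ m"
    unfolding vilenkin_index_def r_def
    by (simp add: vilenkin_group_def vilenkin_delta_eq[OF p l] w)
  ultimately show ?thesis by simp
qed

lemma bij_betw_add_mod:
  fixes c p :: nat
  shows "bij_betw (\<lambda>l. (c + l) mod p) {0..<p} {0..<p}"
proof -
  have "inj_on (\<lambda>l. (c + l) mod p) {0..<p}"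
  proof (rule inj_onI)
    fix x y assume xy: "x \<in> {0..<p}" "y \<in> {0..<p}" "(c + x) mod p = (c + y) mod p"
    \<comment> \<open>Adding \<open>p * c - c\<close> completes \<open>c\<close> to a multiple of
      \<open>p\<close>, which cancels \<open>c\<close> without negative numbers; \<open>p\<close> is
      positive here, so the subtraction is not truncated.\<close>
    have shift: "(c + z) + (p * c - c) = z + p * c" for z
      using xy(1) by (cases p) auto
    have "((c + x) + (p * c - c)) mod p = ((c + y) + (p * c - c)) mod p"
      by (rule mod_add_cong[OF xy(3) refl])
    then have "x mod p = y mod p" by (simp only: shift mod_mult_self2)
    then show "x = y" using xy by simp
  qed
  moreover have "(\<lambda>l. (c + l) mod p) ` {0..<p} \<subseteq> {0..<p}" by auto
  ultimately show ?thesis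
    by (simp add: bij_betw_def endo_inj_surj)
qed

text \<open>As \<open>l\<close> runs over all residues, so does the rotated leading digit; the sum
  depends only on the lower digits.\<close>

lemma sum_vilenkin_delta_orbit:
  fixes f :: "nat \<Rightarrow> real"
  assumes p: "p \<ge> 2" and \<omega>: "\<omega> \<in> carrier (vilenkin_group p)"
  shows "(\<Sum>l=0..<p. f (vilenkin_index p (Suc m) (\<omega> \<otimes>\<^bsub>vilenkin_group p\<^esub> vilenkin_delta p l))) =
    (\<Sum>k=0..<p. f (vilenkin_index p (Suc m) \<omega> mod p ^ m + k * p ^ m))"
  using sum.reindex_bij_betw[OF bij_betw_add_mod[of "\<omega> 1" p],
      of "\<lambda>k. f (vilenkin_index p (Suc m) \<omega> mod p ^ m + k * p ^ m)"]
  by (simp add: vilenkin_index_mult_delta[OF p _ \<omega>])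

section \<open>Equivalence of the conditions on the polynomial and on its values\<close>

theorem proposition13:
  fixes p n :: nat and a :: "nat \<Rightarrow> complex" and m\<^sub>0 :: "(int \<Rightarrow> nat) \<Rightarrow> complex"
  assumes "p \<ge> 2" and "n \<ge> 1"
    and "\<And>\<omega>. \<omega> \<in> carrier (vilenkin_group p) \<Longrightarrow>
           m\<^sub>0 \<omega> = (\<Sum>\<alpha> = 0..<p ^ n. a \<alpha> * cnj (walsh p \<alpha> \<omega>))"
  shows "(m\<^sub>0 \<one>\<^bsub>vilenkin_group p\<^esub> = 1 \<and>
          (\<forall>\<omega>\<in>carrier (vilenkin_group p).
             (\<Sum>l = 0..<p. (cmod (m\<^sub>0 (\<omega> \<otimes>\<^bsub>vilenkin_group p\<^esub> vilenkin_delta p l)))\<^sup>2) \<le> 1))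
     \<longleftrightarrow> (\<exists>b :: nat \<Rightarrow> complex.
          (\<forall>\<alpha><p ^ n. a \<alpha> = 1 / of_nat (p ^ n) *
             (\<Sum>s = 0..<p ^ n. b s * walsh p \<alpha> ((inv_into UNIV vilenkin_A ^^ n) (vilenkin_h p s)))) \<and>
          b 0 = 1 \<and>
          (\<forall>l<p ^ (n - 1). (\<Sum>k = 0..<p. (cmod (b (l + k * p ^ (n - 1))))\<^sup>2) \<le> 1))"
proof -
  note p = assms(1)
  interpret G: comm_group "vilenkin_group p"
    using p by (intro comm_group_vilenkin_group) simp
  obtain m where n: "n = Suc m" using assms(2) by (cases n) auto
  define x where "x = (\<lambda>s. (inv_into UNIV vilenkin_A ^^ n) (vilenkin_h p s))"
  \<comment> \<open>The values of the polynomial as a function of the index, the only possible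
    choice below \<open>p ^ n\<close>.\<close>
  define b where "b = (\<lambda>s. \<Sum>\<alpha> = 0..<p ^ n. a \<alpha> * cnj (vc_kernel p n \<alpha> s))"
  have x_eq: "(inv_into UNIV vilenkin_A ^^ n) (vilenkin_h p s) = x s" for s
    by (simp only: x_def)
  have m: "n - 1 = m" by (simp only: n diff_Suc_1)
  have x: "x s \<in> carrier (vilenkin_group p)" for s
    unfolding x_def by (intro inv_vilenkin_A_funpow_carrier vilenkin_h_digit p)
  have index_x: "vilenkin_index p n (x s) = s" if "s < p ^ n" for s
    unfolding x_def using that p by (rule vilenkin_index_inv_A_h[rotated])
  have walsh_x: "walsh p \<alpha> (x s) = vc_kernel p n \<alpha> s" if "\<alpha> < p ^ n" "s < p ^ n" for \<alpha> s
    using walsh_eq_vc_kernel[OF p that(1) x] index_x that by simp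
  have m0: "m\<^sub>0 \<omega> = b (vilenkin_index p n \<omega>)" if "\<omega> \<in> carrier (vilenkin_group p)" for \<omega>
    using assms(3)[OF that] walsh_eq_vc_kernel[OF p _ that] by (simp add: b_def)
  \<comment> \<open>The two inversion formulas give one direction each; the existential quantifier
    over \<open>c\<close> then reduces to \<open>b\<close>.\<close>
  have transform: "(\<forall>\<alpha><p ^ n. a \<alpha> = 1 / of_nat (p ^ n) * (\<Sum>s = 0..<p ^ n. c s * walsh p \<alpha> (x s)))
      \<longleftrightarrow> (\<forall>s<p ^ n. c s = b s)" for c
  proof
    assume "\<forall>\<alpha><p ^ n. a \<alpha> = 1 / of_nat (p ^ n) * (\<Sum>s = 0..<p ^ n. c s * walsh p \<alpha> (x s))"
    then have a: "a \<alpha> = 1 / of_nat (p ^ n) * (\<Sum>s = 0..<p ^ n. c s * vc_kernel p n \<alpha> s)"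
      if "\<alpha> < p ^ n" for \<alpha>
      using that walsh_x by simp
    show "\<forall>s<p ^ n. c s = b s"
    proof (intro allI impI)
      fix t assume t: "t < p ^ n"
      have "b t = (\<Sum>\<alpha>=0..<p ^ n. (1 / of_nat (p ^ n) *
          (\<Sum>s=0..<p ^ n. c s * vc_kernel p n \<alpha> s)) * cnj (vc_kernel p n \<alpha> t))"
        unfolding b_def by (rule sum.cong) (simp_all add: a)
      also have "\<dots> = c t" using p t by (intro vc_transform_inverse) auto
      finally show "c t = b t" by simp
    qed
  next
    assume c: "\<forall>s<p ^ n. c s = b s"
    show "\<forall>\<alpha><p ^ n. a \<alpha> = 1 / of_nat (p ^ n) * (\<Sum>s = 0..<p ^ n. c s * walsh p \<alpha> (x s))"
    proof (intro allI impI)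
      fix \<alpha> assume \<alpha>: "\<alpha> < p ^ n"
      have "(\<Sum>s = 0..<p ^ n. c s * walsh p \<alpha> (x s)) = (\<Sum>s = 0..<p ^ n. b s * vc_kernel p n \<alpha> s)"
        using c \<alpha> by (intro sum.cong) (simp_all add: walsh_x)
      then show "a \<alpha> = 1 / of_nat (p ^ n) * (\<Sum>s = 0..<p ^ n. c s * walsh p \<alpha> (x s))"
        using vc_transform_inverse'[of p \<alpha> n a] p \<alpha> by (simp add: b_def)
    qed
  qed
  have value_at_one: "m\<^sub>0 \<one>\<^bsub>vilenkin_group p\<^esub> = b 0"
    using m0[OF G.one_closed] by (simp add: vilenkin_index_def vilenkin_group_def)
  have delta: "vilenkin_delta p l \<in> carrier (vilenkin_group p)" if "l < p" for l
  proof -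
    have "{j. j < 0 \<and> vilenkin_delta p l j \<noteq> 0} = {}"
      using that by (auto simp: vilenkin_delta_eq[OF p])
    then show ?thesis
      using that by (auto simp: vilenkin_group_def vilenkin_delta_eq[OF p])
  qed
  have orbit: "(\<Sum>l = 0..<p. (cmod (m\<^sub>0 (\<omega> \<otimes>\<^bsub>vilenkin_group p\<^esub> vilenkin_delta p l)))\<^sup>2) =
      (\<Sum>k = 0..<p. (cmod (b (vilenkin_index p n \<omega> mod p ^ m + k * p ^ m)))\<^sup>2)"
    if "\<omega> \<in> carrier (vilenkin_group p)" for \<omega>
    using sum_vilenkin_delta_orbit[OF p that, of "\<lambda>s. (cmod (b s))\<^sup>2" m] that delta
    by (simp add: m0 n)
  have bound: "(\<forall>\<omega>\<in>carrier (vilenkin_group p).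
      (\<Sum>l = 0..<p. (cmod (m\<^sub>0 (\<omega> \<otimes>\<^bsub>vilenkin_group p\<^esub> vilenkin_delta p l)))\<^sup>2) \<le> 1) \<longleftrightarrow>
    (\<forall>l<p ^ m. (\<Sum>k = 0..<p. (cmod (b (l + k * p ^ m)))\<^sup>2) \<le> 1)" (is "?L \<longleftrightarrow> ?R")
  proof
    assume L: ?L
    show ?R
    proof (intro allI impI)
      fix l assume l: "l < p ^ m"
      \<comment> \<open>This makes \<open>index_x\<close> applicable to \<open>x l\<close>, whose
        index \<open>l\<close> is its own residue modulo \<open>p ^ m\<close>.\<close>
      also have "p ^ m \<le> p ^ n" using p by (simp add: n)
      finally show "(\<Sum>k = 0..<p. (cmod (b (l + k * p ^ m)))\<^sup>2) \<le> 1"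
        using bspec[OF L x[of l]] orbit[OF x[of l]] l by (simp add: index_x)
    qed
  next
    assume ?R
    then show ?L using p by (simp add: orbit)
  qed
  have idx: "l + k * p ^ m < p ^ n" if "l < p ^ m" "k < p" for l k
  proof -
    have "l + k * p ^ m < Suc k * p ^ m" using that by simp
    also have "\<dots> \<le> p * p ^ m" using that by (intro mult_right_mono) auto
    finally show ?thesis by (simp add: n)
  qed
  \<comment> \<open>Only values at indices below \<open>p ^ n\<close> enter the conditions, by
    \<open>idx\<close>, so agreement with \<open>b\<close> there suffices.\<close>
  have "(\<exists>c. (\<forall>s<p ^ n. c s = b s) \<and> c 0 = 1 \<and>
      (\<forall>l<p ^ m. (\<Sum>k = 0..<p. (cmod (c (l + k * p ^ m)))\<^sup>2) \<le> 1)) \<longleftrightarrow>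
    b 0 = 1 \<and> (\<forall>l<p ^ m. (\<Sum>k = 0..<p. (cmod (b (l + k * p ^ m)))\<^sup>2) \<le> 1)"
    using p by (auto simp: idx)
  then show ?thesis
    unfolding x_eq transform value_at_one bound m by (rule sym)
qed

end
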